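(* Let $\alpha>0$ and $\beta>0$ be fixed real numbers. Let $X$ be an absolutely continuous real random variable with cumulative distribution function $F$ and probability density function $f$, such that $E(X)$ exists, $\inf\{x: F(x)>0\}=0$, $\sup\{x: F(x)<1\}=1$, and $f$ is differentiable on $(0,1)$. For $x\in(0,1)$ put $r(x)=\frac{f(x)}{1-F(x)}$ and $$h(x)=\frac{\alpha^{1/\beta}}{\alpha\beta}\exp\left(\frac{\alpha}{x^{\beta}}\right)x^{1+\beta}\left[\Gamma\left(1-\frac1\beta;\alpha\right)-\Gamma\left(1-\frac1\beta;\frac{\alpha}{x^{\beta}}\right)\right].$$ Then $$E(X\mid X\ge x)=h(x)\,r(x)\quad\text{for all }x\in(0,1)$$ if and only if $$f(x)=\frac{\alpha\beta\exp\left[-\alpha\left(1/x^{\beta}-1\right)\right]}{x^{1+\beta}}\quad\text{for all }x\in(0,1).$$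
   Context: For real $s$ and $x>0$, $\Gamma(s;x)=\int_x^\infty t^{s-1}e^{-t}\,dt$ denotes the upper incomplete gamma function. The conditional expectation is $E(X\mid X\ge x)=\frac{1}{1-F(x)}\int_{x}^{1}t f(t)\,dt$. The density $f(x)=\alpha\beta\, x^{-1-\beta}\exp[-\alpha(x^{-\beta}-1)]$ on $(0,1)$ is that of the unit-Gompertz distribution with parameters $\alpha,\beta$, whose cumulative distribution function on $(0,1)$ is $\exp[-\alpha(x^{-\beta}-1)]$. *)

theory Defs
  imports "HOL-Probability.Probability"
begin

definition upper_inc_Gamma :: "real \<Rightarrow> real \<Rightarrow> real" where
  "upper_inc_Gamma s x = (LINT t:{x..}|lborel. t powr (s - 1) * exp (- t))"

(* E(X | X \<ge> x) for a random variable with cdf F and density f whose support has supremum 1;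
   this is why the integral stops at 1. *)
definition cond_mean_above :: "(real \<Rightarrow> real) \<Rightarrow> (real \<Rightarrow> real) \<Rightarrow> real \<Rightarrow> real" where
  "cond_mean_above F f x = 1 / (1 - F x) * (LINT t:{x..1}|lborel. t * f t)"

definition hazard_rate :: "(real \<Rightarrow> real) \<Rightarrow> (real \<Rightarrow> real) \<Rightarrow> real \<Rightarrow> real" where
  "hazard_rate F f x = f x / (1 - F x)"

definition h_fun :: "real \<Rightarrow> real \<Rightarrow> real \<Rightarrow> real" where
  "h_fun \<alpha> \<beta> x =
     \<alpha> powr (1 / \<beta>) / (\<alpha> * \<beta>) * exp (\<alpha> / x powr \<beta>) * x powr (1 + \<beta>) *
     (upper_inc_Gamma (1 - 1 / \<beta>) \<alpha> - upper_inc_Gamma (1 - 1 / \<beta>) (\<alpha> / x powr \<beta>))"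

end

(* Let f0 and G be the unit-Gompertz density and cdf, m(x) the integral of t f(t) over [x, 1], and
   A the function m of f0 (an incomplete gamma expression). Then h = A / f0, so the condition reads
   m f0 = A f. Both m' = - x f and A' = - x f0 hold, and m and A vanish at 1. If f = f0 then m = A
   follows. Conversely m f0 = A f gives (m / A)' = 0, hence f = c f0, so F - c G is constant;
   comparing the values at 0 and 1 yields c = 1. *)
theory Submission
  imports Defs "HOL-Real_Asymp.Real_Asymp"
begin

section \<open>Tail integrals on the line and the upper incomplete gamma function\<close>

lemma set_integral_lborel_singleton:
  fixes g :: "real \<Rightarrow> real"
  shows "(LINT t:{c}|lborel. g t) = 0"
  unfolding set_lebesgue_integral_def
  by (rule integral_eq_zero_AE) (use AE_lborel_singleton[of c] in auto)

text \<open>Reduces an infinite tail to a fixed constant minus an integral over a compact interval,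
  where continuity and differentiability of indefinite integrals are available.\<close>

lemma set_integral_tail_eq:
  fixes g :: "real \<Rightarrow> real"
  assumes g: "set_integrable lborel {a..} g" and "a \<le> y"
  shows "(LINT t:{y..}|lborel. g t) = (LINT t:{a..}|lborel. g t) - integral {a..y} g"
proof -
  have g_sub: "set_integrable lborel T g" if "T \<in> sets borel" "T \<subseteq> {a..}" for T
    using set_integrable_subset[OF g] that by simp
  have "{a..} = {a..y} \<union> {y<..}" using \<open>a \<le> y\<close> by auto
  then have "(LINT t:{a..}|lborel. g t) = (LINT t:{a..y}|lborel. g t) + (LINT t:{y<..}|lborel. g t)"
    using \<open>a \<le> y\<close> by (simp only:) (intro set_integral_Un g_sub, auto)
  moreover have "{y..} = {y} \<union> {y<..}" by auto
  then have "(LINT t:{y..}|lborel. g t) = (LINT t:{y}|lborel. g t) + (LINT t:{y<..}|lborel. g t)"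
    using \<open>a \<le> y\<close> by (simp only:) (intro set_integral_Un g_sub, auto)
  moreover have "(LINT t:{a..y}|lborel. g t) = integral {a..y} g"
    by (intro set_borel_integral_eq_integral g_sub) auto
  ultimately show ?thesis by (simp add: set_integral_lborel_singleton)
qed

lemma continuous_on_set_integral_tail:
  fixes g :: "real \<Rightarrow> real"
  assumes g: "set_integrable lborel {a..} g"
  shows "continuous_on {a..b} (\<lambda>y. LINT t:{y..}|lborel. g t)"
proof -
  have "g integrable_on {a..b}"
    by (intro set_borel_integral_eq_integral set_integrable_subset[OF g]) auto
  then have "continuous_on {a..b} (\<lambda>y. (LINT t:{a..}|lborel. g t) - integral {a..y} g)"
    by (intro continuous_intros indefinite_integral_continuous_1)
  then show ?thesis
    by (rule continuous_on_eq) (auto intro: set_integral_tail_eq[OF g, symmetric])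
qed

lemma DERIV_set_integral_tail:
  fixes g :: "real \<Rightarrow> real"
  assumes g: "set_integrable lborel {a..} g" and "a < x" and "isCont g x"
  shows "((\<lambda>y. LINT t:{y..}|lborel. g t) has_real_derivative - g x) (at x)"
proof -
  have "g integrable_on {a..x+1}"
    by (intro set_borel_integral_eq_integral set_integrable_subset[OF g]) auto
  then have "((\<lambda>u. integral {a..u} g) has_vector_derivative g x) (at x within {a..x+1} - {})"
    using assms
    by (intro integral_has_vector_derivative_continuous_at) (auto intro: continuous_at_imp_continuous_at_within)
  moreover have "at x within {a..x+1} = at x"
    using \<open>a < x\<close> by (intro at_within_interior) auto
  ultimately have "((\<lambda>u. integral {a..u} g) has_real_derivative g x) (at x)"
    by (simp add: has_real_derivative_iff_has_vector_derivative)
  then have "((\<lambda>y. (LINT t:{a..}|lborel. g t) - integral {a..y} g) has_real_derivative - g x) (at x)"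
    by (auto intro!: derivative_eq_intros)
  \<comment> \<open>The two functions agree only for arguments at least \<open>a\<close>, so the
    derivative is transferred on the open half-line \<open>{a<..}\<close> around
    \<open>x\<close>.\<close>
  then show ?thesis
    by (rule has_field_derivative_transform_within_open[where S = "{a<..}"])
      (use \<open>a < x\<close> in \<open>auto intro: set_integral_tail_eq[OF g, symmetric]\<close>)
qed

text \<open>Here \<open>s\<close> may be negative or zero, as happens for
  \<open>s = 1 - 1 / \<beta>\<close> with \<open>\<beta> \<le> 1\<close>. Away from 0 the integrand
  is dominated by a multiple of the integrand of a complete gamma integral with parameter
  \<open>p = max s 1\<close>.\<close>

lemma set_integrable_upper_inc_Gamma:
  fixes a s :: real
  assumes "a > 0"
  shows "set_integrable lborel {a..} (\<lambda>t. t powr (s - 1) * exp (- t))"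
proof -
  define p where "p = max s 1"
  have "p > 0" "s \<le> p" by (auto simp: p_def)
  let ?G = "\<lambda>t::real. t powr (p - 1) / exp t"
  have "?G absolutely_integrable_on {0..}"
    using Gamma_integral_real[OF \<open>p > 0\<close>]
    by (intro nonnegative_absolutely_integrable_1) (auto simp: integrable_on_def)
  \<comment> \<open>Absolute integrability refers to the completed measure; \<open>?G\<close> is
    Borel measurable, so it passes to \<open>lborel\<close>.\<close>
  then have "set_integrable lborel {0..} ?G"
    unfolding set_integrable_def by (subst (asm) integrable_completion) simp_all
  then have "set_integrable lborel {a..} ?G"
    by (rule set_integrable_subset) (use \<open>a > 0\<close> in auto)
  then have G: "set_integrable lborel {a..} (\<lambda>t. a powr (s - p) * ?G t)"
    by (rule set_integrable_mult_right)
  have "t powr (s - 1) * exp (- t) \<le> a powr (s - p) * ?G t" if "t \<ge> a" for t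
  proof -
    have "t powr (s - 1) = t powr (s - p) * t powr (p - 1)"
      by (simp flip: powr_add)
    \<comment> \<open>The exponent \<open>s - p\<close> is at most 0, so the power is antitone in
      the base.\<close>
    also have "\<dots> \<le> a powr (s - p) * t powr (p - 1)"
      using that \<open>a > 0\<close> \<open>s \<le> p\<close> by (intro mult_right_mono powr_mono2') auto
    finally show ?thesis by (simp add: exp_minus field_simps)
  qed
  then show ?thesis
    by (intro set_integrable_bound[OF G]) (auto simp: set_borel_measurable_def abs_mult)
qed

lemma DERIV_upper_inc_Gamma:
  assumes "x > 0"
  shows "(upper_inc_Gamma s has_real_derivative - (x powr (s - 1) * exp (- x))) (at x)"
  unfolding upper_inc_Gamma_def[abs_def]
  by (rule DERIV_set_integral_tail[where a = "x / 2"])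
    (use assms in \<open>auto intro!: set_integrable_upper_inc_Gamma continuous_intros\<close>)

text \<open>Fixes the constant between two antiderivatives by their values at the right end
  \<open>b\<close>, where only continuity is at hand. It serves to compare tail means and
  distribution functions at 1.\<close>

lemma diff_eq_diff_at_end_if_same_DERIV:
  fixes u v :: "real \<Rightarrow> real"
  assumes u: "\<And>x. a < x \<Longrightarrow> x < b \<Longrightarrow> (u has_real_derivative d x) (at x)"
    and v: "\<And>x. a < x \<Longrightarrow> x < b \<Longrightarrow> (v has_real_derivative d x) (at x)"
    and cu: "\<And>x. a < x \<Longrightarrow> continuous_on {x..b} u"
    and cv: "\<And>x. a < x \<Longrightarrow> continuous_on {x..b} v"
    and x: "a < x" "x < b"
  shows "u x - v x = u b - v b"
proof -
  have "(\<lambda>x. u x - v x) b = (\<lambda>x. u x - v x) x"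
  proof (rule DERIV_isconst_end[where f = "\<lambda>x. u x - v x"])
    show "continuous_on {x..b} (\<lambda>x. u x - v x)"
      using x by (intro continuous_intros cu cv)
    show "((\<lambda>x. u x - v x) has_real_derivative 0) (at y)" if "x < y" "y < b" for y
      using DERIV_diff[OF u v, of y] that x by simp
  qed fact
  then show ?thesis by simp
qed

section \<open>The unit-Gompertz distribution and its tail mean\<close>

definition gompertz_density :: "real \<Rightarrow> real \<Rightarrow> real \<Rightarrow> real" where
  "gompertz_density \<alpha> \<beta> x = \<alpha> * \<beta> * exp (- \<alpha> * (1 / x powr \<beta> - 1)) / x powr (1 + \<beta>)"

definition gompertz_cdf :: "real \<Rightarrow> real \<Rightarrow> real \<Rightarrow> real" where
  "gompertz_cdf \<alpha> \<beta> x = exp (- \<alpha> * (1 / x powr \<beta> - 1))"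

text \<open>Closed form of \<open>\<integral> t f\<^sub>0(t) dt\<close> over \<open>[x, 1]\<close>, where \<open>f\<^sub>0\<close> is the unit-Gompertz density.\<close>
definition gompertz_tail_mean :: "real \<Rightarrow> real \<Rightarrow> real \<Rightarrow> real" where
  "gompertz_tail_mean \<alpha> \<beta> x = \<alpha> powr (1 / \<beta>) * exp \<alpha> *
     (upper_inc_Gamma (1 - 1 / \<beta>) \<alpha> - upper_inc_Gamma (1 - 1 / \<beta>) (\<alpha> / x powr \<beta>))"

context
  fixes \<alpha> \<beta> :: real
  assumes pos: "\<alpha> > 0" "\<beta> > 0"
begin

lemma gompertz_density_pos: "x > 0 \<Longrightarrow> gompertz_density \<alpha> \<beta> x > 0"
  using pos by (simp add: gompertz_density_def)

lemma DERIV_gompertz_cdf: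
  assumes "x > 0"
  shows "(gompertz_cdf \<alpha> \<beta> has_real_derivative gompertz_density \<alpha> \<beta> x) (at x)"
proof -
  have "((\<lambda>x. exp (- \<alpha> * (x powr (-\<beta>) - 1))) has_real_derivative
      exp (- \<alpha> * (x powr (-\<beta>) - 1)) * (- \<alpha> * (- \<beta> * x powr (-\<beta> - 1)))) (at x)"
    using assms by (auto intro!: derivative_eq_intros)
  moreover have "x powr (-\<beta> - 1) = 1 / x powr (1 + \<beta>)"
    using powr_minus_divide[of x "1 + \<beta>"] by (simp add: minus_diff_commute)
  ultimately show ?thesis
    by (simp add: gompertz_cdf_def[abs_def] gompertz_density_def powr_minus_divide mult_ac)
qed

text \<open>A limit is needed here: division by zero yields 0, so the formula takes the value
  \<open>exp \<alpha>\<close> at 0 itself.\<close>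

lemma gompertz_cdf_tendsto_0: "(gompertz_cdf \<alpha> \<beta> \<longlongrightarrow> 0) (at_right 0)"
proof -
  have "filterlim (\<lambda>x. x powr (-\<beta>)) at_top (at_right (0::real))"
    using pos by real_asymp
  then have "filterlim (\<lambda>x. - \<alpha> * (x powr (-\<beta>) - 1)) at_bot (at_right 0)"
    using pos by real_asymp
  from filterlim_compose[OF exp_at_bot this] show ?thesis
    by (simp add: gompertz_cdf_def[abs_def] powr_minus_divide)
qed

text \<open>Chain rule with the inner function \<open>y = \<alpha> * x powr (-\<beta>)\<close>.
  Since \<open>s - 1 = - (1 / \<beta>)\<close>, the power \<open>y powr (s - 1)\<close> equals
  \<open>\<alpha> powr (- (1 / \<beta>)) * x\<close>; this produces the factor \<open>x\<close> and
  cancels the leading constant.\<close>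

lemma DERIV_gompertz_tail_mean:
  assumes "x > 0"
  shows "(gompertz_tail_mean \<alpha> \<beta> has_real_derivative - (x * gompertz_density \<alpha> \<beta> x)) (at x)"
proof -
  define s y where "s = 1 - 1 / \<beta>" and "y = \<alpha> * x powr (-\<beta>)"
  have "y > 0" using assms pos by (simp add: y_def)
  have "((\<lambda>x. upper_inc_Gamma s (\<alpha> * x powr (-\<beta>))) has_real_derivative
      - (y powr (s - 1) * exp (- y)) * (\<alpha> * (- \<beta> * x powr (-\<beta> - 1)))) (at x)"
    unfolding y_def
    by (rule DERIV_chain2[OF DERIV_upper_inc_Gamma])
      (use assms pos in \<open>auto intro!: derivative_eq_intros\<close>)
  then have D: "(gompertz_tail_mean \<alpha> \<beta> has_real_derivative \<alpha> powr (1 / \<beta>) * exp \<alpha> *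
      ((y powr (s - 1) * exp (- y)) * (\<alpha> * (- \<beta> * x powr (-\<beta> - 1))))) (at x)"
    unfolding gompertz_tail_mean_def[abs_def] s_def
    by (auto intro!: derivative_eq_intros simp: powr_minus_divide)
  have "\<alpha> powr (1 / \<beta>) * y powr (s - 1) = x"
  proof -
    have "y powr (s - 1) = \<alpha> powr (- (1 / \<beta>)) * x"
      using assms pos by (simp add: y_def s_def powr_mult powr_powr)
    then show ?thesis using pos by (simp add: powr_minus)
  qed
  moreover have "x powr (-\<beta> - 1) = 1 / x powr (1 + \<beta>)"
    using powr_minus_divide[of x "1 + \<beta>"] by (simp add: minus_diff_commute)
  moreover have "exp \<alpha> * exp (- y) = exp (- \<alpha> * (1 / x powr \<beta> - 1))"
    by (simp add: y_def powr_minus_divide algebra_simps flip: exp_add)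
  moreover have "\<alpha> powr (1 / \<beta>) * exp \<alpha> * ((y powr (s - 1) * exp (- y)) * (\<alpha> * (- \<beta> * x powr (-\<beta> - 1))))
      = - ((\<alpha> powr (1 / \<beta>) * y powr (s - 1)) * (\<alpha> * \<beta> * (exp \<alpha> * exp (- y)) * x powr (-\<beta> - 1)))"
    by (simp add: mult_ac)
  ultimately have "\<alpha> powr (1 / \<beta>) * exp \<alpha> * ((y powr (s - 1) * exp (- y)) * (\<alpha> * (- \<beta> * x powr (-\<beta> - 1))))
      = - (x * gompertz_density \<alpha> \<beta> x)"
    by (simp only: gompertz_density_def) simp
  with D show ?thesis by simp
qed

lemma gompertz_tail_mean_1: "gompertz_tail_mean \<alpha> \<beta> 1 = 0"
  by (simp add: gompertz_tail_mean_def)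

text \<open>The derivative is negative on the positive axis and the value at 1 is 0. Positivity
  permits division by the tail mean later.\<close>

lemma gompertz_tail_mean_pos:
  assumes "0 < x" "x < 1"
  shows "gompertz_tail_mean \<alpha> \<beta> x > 0"
proof -
  have "gompertz_tail_mean \<alpha> \<beta> x > gompertz_tail_mean \<alpha> \<beta> 1"
  proof (rule DERIV_neg_imp_decreasing[of x 1])
    fix y assume "x \<le> y" "y \<le> 1"
    then have "y > 0" using assms by simp
    then show "\<exists>d. (gompertz_tail_mean \<alpha> \<beta> has_real_derivative d) (at y) \<and> d < 0"
      using DERIV_gompertz_tail_mean[of y] gompertz_density_pos[of y]
      by (intro exI[of _ "- (y * gompertz_density \<alpha> \<beta> y)"]) simp
  qed fact
  then show ?thesis by (simp add: gompertz_tail_mean_1)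
qed

text \<open>Explains the shape of \<open>h_fun\<close>: the factor in front of the gamma difference
  is the reciprocal of the density, up to the constants of the tail mean.\<close>

lemma h_fun_eq:
  assumes "x > 0"
  shows "h_fun \<alpha> \<beta> x = gompertz_tail_mean \<alpha> \<beta> x / gompertz_density \<alpha> \<beta> x"
proof -
  have "exp (- \<alpha> * (1 / x powr \<beta> - 1)) = exp \<alpha> / exp (\<alpha> / x powr \<beta>)"
    by (simp add: algebra_simps flip: exp_diff)
  moreover have "x powr (1 + \<beta>) > 0"
    using assms by simp
  ultimately show ?thesis
    using pos unfolding h_fun_def gompertz_tail_mean_def gompertz_density_def
    by (simp only:) (simp add: field_simps)
qed

end

section \<open>Measures with a Lebesgue density\<close>

lemma measure_density_lborel:
  fixes f :: "real \<Rightarrow> real"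
  assumes "integrable lborel f" "\<And>x. 0 \<le> f x" "S \<in> sets borel"
  shows "measure (density lborel (\<lambda>x. ennreal (f x))) S = (LINT x:S|lborel. f x)"
proof -
  have "emeasure (density lborel (\<lambda>x. ennreal (f x))) S = (\<integral>\<^sup>+x. ennreal (indicator S x *\<^sub>R f x) \<partial>lborel)"
    using assms by (subst emeasure_density) (auto intro!: nn_integral_cong split: split_indicator)
  also have "\<dots> = ennreal (LINT x:S|lborel. f x)"
    unfolding set_lebesgue_integral_def
    using assms by (intro nn_integral_eq_integral integrable_mult_indicator) auto
  finally show ?thesis
    using assms by (simp add: measure_def set_lebesgue_integral_def integral_nonneg_AE)
qed

theorem theorem2p4:
  fixes \<alpha> \<beta> :: real
    and M :: "'a measure"
    and X :: "'a \<Rightarrow> real"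
    and F f :: "real \<Rightarrow> real"
  assumes "\<alpha> > 0" and "\<beta> > 0"
    and "prob_space M"
    and "distributed M lborel X (\<lambda>x. ennreal (f x))" and "\<And>x. 0 \<le> f x"
    and "F = cdf (distr M borel X)"
    and "integrable M X"
    and "Inf {ereal x | x. F x > 0} = 0"
    and "Sup {ereal x | x. F x < 1} = 1"
    and "f differentiable_on {0<..<1}"
  shows "(\<forall>x\<in>{0<..<1}. cond_mean_above F f x = h_fun \<alpha> \<beta> x * hazard_rate F f x)
     \<longleftrightarrow> (\<forall>x\<in>{0<..<1}. f x =
            \<alpha> * \<beta> * exp (- \<alpha> * (1 / x powr \<beta> - 1)) / x powr (1 + \<beta>))"
proof -
  note pos = \<open>\<alpha> > 0\<close> \<open>\<beta> > 0\<close>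
  interpret prob_space M by fact
  define m where "m x = (LINT t:{x..1}|lborel. t * f t)" for x
  define S where "S x = (LINT t:{x..}|lborel. f t)" for x
  let ?A = "gompertz_tail_mean \<alpha> \<beta>"
  let ?f0 = "gompertz_density \<alpha> \<beta>"
  let ?G = "gompertz_cdf \<alpha> \<beta>"

  \<comment> \<open>Regularity and boundary values of the distribution function\<close>
  have f_nonneg: "0 \<le> f x" for x by fact
  have "(\<lambda>x. ennreal (f x)) \<in> borel_measurable borel"
    using distributed_borel_measurable[OF assms(4)] by simp
  \<comment> \<open>Measurability is given only for \<open>f\<close> cast to extended reals;
    nonnegativity makes the cast reversible.\<close>
  then have "(\<lambda>x. enn2real (ennreal (f x))) \<in> borel_measurable borel"
    by measurable
  then have f_meas [measurable]: "f \<in> borel_measurable borel"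
    by (simp add: f_nonneg)
  have distr: "distr M borel X = density lborel (\<lambda>x. ennreal (f x))"
    using distributed_distr_eq_density[OF assms(4)] by (simp cong: distr_cong)
  have X [measurable]: "X \<in> borel_measurable M"
    using distributed_measurable[OF assms(4)] by simp
  interpret D: real_distribution "distr M borel X" by simp
  have "(\<integral>\<^sup>+x. ennreal (f x) \<partial>lborel) = 1"
    using D.emeasure_space_1 unfolding distr by (simp add: emeasure_density)
  then have f_int: "integrable lborel f"
    by (intro integrableI_nonneg) (auto simp: f_nonneg)
  have f_set_int: "set_integrable lborel T f" if "T \<in> sets borel" for T
    unfolding set_integrable_def using f_int that by (intro integrable_mult_indicator) auto
  have measure_X: "D.prob T = (LINT x:T|lborel. f x)" if "T \<in> sets borel" for T
    unfolding distr by (rule measure_density_lborel[OF f_int f_nonneg that])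

  have F_eq: "F x = 1 - S x" for x
  proof -
    \<comment> \<open>Points are null, so the closed tail \<open>{x..}\<close> may replace the
      complement of \<open>{..x}\<close>.\<close>
    have "D.prob {x} = 0" by (simp add: measure_X set_integral_lborel_singleton)
    moreover have "D.prob {..x} = D.prob {..<x} + D.prob {x}"
      by (subst D.finite_measure_Union[symmetric]) (auto intro!: arg_cong[of _ _ D.prob])
    moreover have "D.prob {..<x} = 1 - D.prob {x..}"
    proof -
      have "{..<x} = space (distr M borel X) - {x..}" by auto
      then show ?thesis by (simp only: D.prob_compl) (subst D.prob_compl, auto)
    qed
    ultimately show ?thesis
      using assms(6) by (simp add: cdf_def measure_X S_def)
  qed
  have F_mono: "F x \<le> F y" if "x \<le> y" for x y
    using assms(6) that by (simp add: D.cdf_nondecreasing)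
  have F_bounds: "0 \<le> F x" "F x \<le> 1" for x
    using assms(6) by (auto simp: D.cdf_nonneg D.cdf_bounded_prob)
  have F_cont: "continuous_on {a..b} F" for a b
    unfolding F_eq[abs_def] S_def
    by (intro continuous_intros continuous_on_set_integral_tail f_set_int) auto
  have F_lt_1: "F x < 1" if "x < 1" for x
  proof -
    have "ereal x < Sup {ereal x | x. F x < 1}" using assms(9) that by simp
    then obtain y where "x < y" "F y < 1" unfolding less_Sup_iff by auto
    then show ?thesis using F_mono[of x y] by simp
  qed
  \<comment> \<open>The infimum condition forces \<open>F\<close> to vanish on the negative axis,
    and continuity carries this to 0. The value at 1 comes symmetrically from the supremum.\<close>
  have F_0: "F 0 = 0"
  proof -
    have "F y = 0" if "y < 0" for y
    proof (rule ccontr)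
      assume "F y \<noteq> 0"
      then have "F y > 0" using F_bounds(1)[of y] by simp
      then have "Inf {ereal x | x. F x > 0} \<le> ereal y" by (intro Inf_lower) auto
      then show False using assms(8) that by simp
    qed
    moreover have "(F \<longlongrightarrow> F 0) (at_left 0)"
      using F_cont[of "-1" 0] unfolding continuous_on_def
      by (auto simp: at_within_Icc_at_left dest: bspec[of _ _ 0])
    ultimately show ?thesis
      by (intro tendsto_unique[of "at_left 0" F "F 0" 0])
        (auto intro!: tendsto_eventually simp: eventually_at_filter)
  qed
  have F_1: "F 1 = 1"
  proof -
    have "F y = 1" if "y > 1" for y
    proof (rule ccontr)
      assume "F y \<noteq> 1"
      then have "F y < 1" using F_bounds(2)[of y] by simp
      then have "ereal y \<le> Sup {ereal x | x. F x < 1}" by (intro Sup_upper) auto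
      then show False using assms(9) that by simp
    qed
    moreover have "(F \<longlongrightarrow> F 1) (at_right 1)"
      using F_cont[of 1 2] unfolding continuous_on_def
      by (auto simp: at_within_Icc_at_right dest: bspec[of _ _ 1])
    ultimately show ?thesis
      by (intro tendsto_unique[of "at_right 1" F "F 1" 1])
        (auto intro!: tendsto_eventually simp: eventually_at_filter)
  qed

  have f_cont: "isCont f x" if "x \<in> {0<..<1}" for x
    using differentiable_imp_continuous_on[OF assms(10)] that
    by (simp add: continuous_on_eq_continuous_at)
  have F_deriv: "(F has_real_derivative f x) (at x)" if "x \<in> {0<..<1}" for x
  proof -
    have "(S has_real_derivative - f x) (at x)"
      unfolding S_def using that f_cont
      by (intro DERIV_set_integral_tail[where a = 0] f_set_int) auto
    then show ?thesis
      unfolding F_eq[abs_def] by (auto intro!: derivative_eq_intros)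
  qed

  \<comment> \<open>Cutting the integrand off at 1 turns \<open>m\<close> into an infinite tail
    integral, the form treated by the general lemmas.\<close>
  define g where "g t = indicator {..1} t * (t * f t)" for t :: real
  have m_eq: "m = (\<lambda>x. LINT t:{x..}|lborel. g t)"
    by (rule ext) (auto simp: m_def g_def set_lebesgue_integral_def intro!: Bochner_Integration.integral_cong
        split: split_indicator)
  \<comment> \<open>On \<open>{0..}\<close> the cutoff leaves only factors \<open>t\<close> between
    0 and 1, so \<open>f\<close> dominates \<open>g\<close>.\<close>
  have g_int: "set_integrable lborel {0..} g"
    by (rule set_integrable_bound[OF f_set_int])
      (auto simp: g_def set_borel_measurable_def abs_mult f_nonneg mult_left_le_one_le split: split_indicator)
  have m_cont: "continuous_on {x..1} m" if "x > 0" for x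
    unfolding m_eq using that
    by (intro continuous_on_subset[OF continuous_on_set_integral_tail[OF g_int, of 1]]) auto
  have m_1: "m 1 = 0"
    by (simp add: m_def set_integral_lborel_singleton)
  have m_deriv: "(m has_real_derivative - (x * f x)) (at x)" if "x \<in> {0<..<1}" for x
  proof -
    have "isCont (\<lambda>t. t * f t) x" using f_cont[OF that] by (intro continuous_intros)
    moreover have "eventually (\<lambda>t. g t = t * f t) (nhds x)"
      using eventually_nhds_in_open[of "{..<1}" x] that
      by (auto simp: g_def elim!: eventually_mono)
    ultimately have "isCont g x"
      using isCont_cong[of g "\<lambda>t. t * f t" x] by simp
    then have "(m has_real_derivative - g x) (at x)"
      unfolding m_eq using that by (intro DERIV_set_integral_tail[OF g_int]) auto
    then show ?thesis using that by (simp add: g_def)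
  qed

  \<comment> \<open>Both sides carry the nonzero factor \<open>1 / (1 - F x)\<close>, which cancels;
    then \<open>h_fun\<close> is replaced by its quotient form.\<close>
  have cond_iff: "cond_mean_above F f x = h_fun \<alpha> \<beta> x * hazard_rate F f x
      \<longleftrightarrow> m x * ?f0 x = ?A x * f x" if "x \<in> {0<..<1}" for x
  proof -
    define d where "d = 1 - F x"
    have "d \<noteq> 0" using F_lt_1[of x] that by (simp add: d_def)
    moreover have "?f0 x \<noteq> 0" using gompertz_density_pos[OF pos, of x] that by simp
    ultimately show ?thesis
      using that unfolding cond_mean_above_def hazard_rate_def m_def[symmetric] d_def[symmetric]
      by (simp add: h_fun_eq[OF pos] field_simps)
  qed

  have "(\<forall>x\<in>{0<..<1}. m x * ?f0 x = ?A x * f x) \<longleftrightarrow> (\<forall>x\<in>{0<..<1}. f x = ?f0 x)"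
  proof
    assume eq: "\<forall>x\<in>{0<..<1}. f x = ?f0 x"
    have "m x - ?A x = m 1 - ?A 1" if "x \<in> {0<..<1}" for x
    proof (rule diff_eq_diff_at_end_if_same_DERIV[where a = 0 and d = "\<lambda>x. - (x * f x)"])
      show "continuous_on {y..1} ?A" if "y > 0" for y
        using that by (intro DERIV_continuous_on[OF has_field_derivative_at_within[OF DERIV_gompertz_tail_mean[OF pos]]]) auto
      show "(?A has_real_derivative - (y * f y)) (at y)" if "0 < y" "y < 1" for y
        using DERIV_gompertz_tail_mean[OF pos, of y] eq that by simp
    qed (use that m_cont m_deriv in auto)
    then show "\<forall>x\<in>{0<..<1}. m x * ?f0 x = ?A x * f x"
      using eq by (simp add: m_1 gompertz_tail_mean_1[OF pos])
  next
    assume eq: "\<forall>x\<in>{0<..<1}. m x * ?f0 x = ?A x * f x"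
    \<comment> \<open>The point 1/2 is an arbitrary reference point of the interval, as the quotient
      turns out to be constant.\<close>
    define c where "c = m (1/2) / ?A (1/2)"
    have ratio: "m x / ?A x = c" if "x \<in> {0<..<1}" for x
      unfolding c_def
    proof (rule DERIV_isconst3[where f = "\<lambda>x. m x / ?A x" and a = 0 and b = 1])
      fix y :: real assume y: "y \<in> {0<..<1}"
      have "?A y \<noteq> 0" using gompertz_tail_mean_pos[OF pos, of y] y by simp
      \<comment> \<open>The hypothesis times \<open>y\<close>: exactly the vanishing of the
        numerator in the quotient rule.\<close>
      moreover have "m y * (y * ?f0 y) = y * f y * ?A y"
        using bspec[OF eq y] by (metis mult.assoc mult.commute)
      ultimately show "((\<lambda>x. m x / ?A x) has_real_derivative 0) (at y)"
        using y by (auto intro!: derivative_eq_intros m_deriv DERIV_gompertz_tail_mean[OF pos])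
    qed (use that in auto)
    \<comment> \<open>Substituting \<open>m x = c * ?A x\<close> into the hypothesis, the positive
      factor \<open>?A x\<close> cancels.\<close>
    have f_eq: "f x = c * ?f0 x" if "x \<in> {0<..<1}" for x
      using ratio[OF that] bspec[OF eq that] gompertz_tail_mean_pos[OF pos, of x] that
      by (auto simp: field_simps)
    have G_1: "?G 1 = 1" by (simp add: gompertz_cdf_def)
    have diff: "F x - c * ?G x = 1 - c" if "x \<in> {0<..<1}" for x
    proof -
      have "F x - c * ?G x = F 1 - c * ?G 1"
      proof (rule diff_eq_diff_at_end_if_same_DERIV[where a = 0 and d = f])
        show "continuous_on {y..1} (\<lambda>x. c * ?G x)" if "y > 0" for y
          using that by (intro continuous_intros
              DERIV_continuous_on[OF has_field_derivative_at_within[OF DERIV_gompertz_cdf[OF pos]]]) auto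
        show "((\<lambda>x. c * ?G x) has_real_derivative f y) (at y)" if "0 < y" "y < 1" for y
          using f_eq[of y] that by (auto intro!: derivative_eq_intros DERIV_gompertz_cdf[OF pos])
      qed (use that F_cont F_deriv in auto)
      then show ?thesis by (simp add: F_1 G_1)
    qed
    have "(F \<longlongrightarrow> F 0) (at_right 0)"
      using F_cont[of 0 1] unfolding continuous_on_def
      by (auto simp: at_within_Icc_at_right dest: bspec[of _ _ 0])
    then have "((\<lambda>x. F x - c * ?G x) \<longlongrightarrow> F 0 - c * 0) (at_right 0)"
      by (intro tendsto_intros gompertz_cdf_tendsto_0[OF pos])
    \<comment> \<open>The same function tends to \<open>F 0 = 0\<close> and is constantly
      \<open>1 - c\<close> on the interval; uniqueness of the limit gives
      \<open>c = 1\<close>.\<close>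
    moreover have "((\<lambda>x. F x - c * ?G x) \<longlongrightarrow> 1 - c) (at_right 0)"
      using diff by (intro tendsto_eventually) (auto simp: eventually_at_right_field intro: exI[of _ 1])
    ultimately have "c = 1"
      using tendsto_unique[OF trivial_limit_at_right_real] F_0 by fastforce
    then show "\<forall>x\<in>{0<..<1}. f x = ?f0 x" using f_eq by simp
  qed
  then show ?thesis
    using cond_iff by (simp add: gompertz_density_def)
qed

end
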